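(* Let $0<q<1$, let ${\bf u}$ be a quasi-definite linear functional on polynomials with monic orthogonal polynomial sequence $(p_n)_{n\ge0}$, let $\alpha,N\in\mathbb R$, and suppose that the sequence $(s_n^{(\alpha)}(N;x))_{n\ge 0}$ of monic polynomials orthogonal with respect to $\langle f,g\rangle_S=\langle {\bf u},fg\rangle+N(\mathscr D_qf)(\alpha)(\mathscr D_qg)(\alpha)$ exists. Then for every $n\ge2$ $$(x-\alpha)(x-\alpha q)\,s_n^{(\alpha)}(N;x)=\sum_{\nu=n-2}^{n+2}\lambda_{n,\nu}\,s_\nu^{(\alpha)}(N;x),$$ where $\lambda_{n,n+2}=1$ and, for $n-2\le j\le n+2$, $$\lambda_{n,j}=\frac{a_{j,n}\langle{\bf u},p_n^2\rangle\left(1+N\mathscr K_{q,n+1}^{(1,1)}(\alpha,\alpha)\right)+N(\mathscr D_qp_n)(\alpha)\displaystyle\sum_{i=n+1}^{j+2}a_{j,i}(\mathscr D_qp_i)(\alpha)}{\left(1+N\mathscr K_{q,n}^{(1,1)}(\alpha,\alpha)\right)\|S_j\|_S^2},$$ (an empty sum being $0$), with $$\|S_n\|_S^2:=\langle s_n^{(\alpha)}(N;x),s_n^{(\alpha)}(N;x)\rangle_S=\frac{1+N\mathscr K_{q,n+1}^{(1,1)}(\alpha,\alpha)}{1+N\mathscr K_{q,n}^{(1,1)}(\alpha,\alpha)}\,\langle{\bf u},p_n^2\rangle.$$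
   Context: The $q$-derivative is $(\mathscr D_qf)(x)=\frac{f(qx)-f(x)}{(q-1)x}$ for $x\neq0$ and $(\mathscr D_qf)(0)=f'(0)$. A linear functional ${\bf u}$ on complex polynomials is quasi-definite if all principal Hankel matrices of its moments are non-singular; equivalently there is a unique sequence of monic polynomials $p_n$, $\deg p_n=n$, with $\langle{\bf u},p_np_m\rangle=\langle{\bf u},p_n^2\rangle\delta_{n,m}$ and $\langle{\bf u},p_n^2\rangle\ne0$. The monic polynomials $s_n^{(\alpha)}(N;x)$ satisfy $\deg s_n^{(\alpha)}=n$, $\langle s_n^{(\alpha)},s_m^{(\alpha)}\rangle_S=0$ for $n\neq m$ and $\langle s_n^{(\alpha)},s_n^{(\alpha)}\rangle_S\ne0$. The kernel is $$\mathscr K_{q,n}^{(1,1)}(x,y)=\sum_{k=0}^{n-1}\frac{(\mathscr D_qp_k)(x)(\mathscr D_qp_k)(y)}{\langle{\bf u},p_k^2\rangle}.$$ The numbers $a_{j,i}$ are the coefficients of the expansion $(x-\alpha)(x-\alpha q)s_j^{(\alpha)}(N;x)=\sum_{i}a_{j,i}\,p_i(x)$ (they vanish unless $\max(j-2,0)\le i\le j+2$, and $a_{j,j+2}=1$). *)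

theory Defs
  imports
    "HOL-Analysis.Derivative"
    "HOL-Computational_Algebra.Polynomial"
    "Jordan_Normal_Form.Determinant"
begin

definition q_deriv :: "real \<Rightarrow> (complex \<Rightarrow> complex) \<Rightarrow> complex \<Rightarrow> complex" where
  "q_deriv q f x =
     (if x = 0 then deriv f 0
      else (f (of_real q * x) - f x) / ((of_real q - 1) * x))"

abbreviation linear_functional :: "(complex poly \<Rightarrow> complex) \<Rightarrow> bool" where
  "linear_functional \<equiv> Vector_Spaces.linear smult (*)"

definition hankel_mat :: "(complex poly \<Rightarrow> complex) \<Rightarrow> nat \<Rightarrow> complex mat" where
  "hankel_mat u n = mat n n (\<lambda>(i, j). u (monom 1 (i + j)))"

definition quasi_definite :: "(complex poly \<Rightarrow> complex) \<Rightarrow> bool" where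
  "quasi_definite u \<longleftrightarrow> linear_functional u \<and> (\<forall>n. Determinant.det (hankel_mat u (Suc n)) \<noteq> 0)"

definition monic_orthogonal_seq ::
  "(complex poly \<Rightarrow> complex poly \<Rightarrow> complex) \<Rightarrow> (nat \<Rightarrow> complex poly) \<Rightarrow> bool" where
  "monic_orthogonal_seq B p \<longleftrightarrow>
     (\<forall>n. degree (p n) = n \<and> lead_coeff (p n) = 1) \<and>
     (\<forall>n m. n \<noteq> m \<longrightarrow> B (p n) (p m) = 0) \<and>
     (\<forall>n. B (p n) (p n) \<noteq> 0)"

text \<open>As in the theory of formal orthogonality, the form below is bilinear (no complex
  conjugation), and it need be neither definite nor real-valued.\<close>

definition sobolev_form ::
  "real \<Rightarrow> (complex poly \<Rightarrow> complex) \<Rightarrow> real \<Rightarrow> real \<Rightarrow> complex poly \<Rightarrow> complex poly \<Rightarrow> complex" where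
  "sobolev_form q u \<alpha> N f g =
     u (f * g) + of_real N * q_deriv q (poly f) (of_real \<alpha>) * q_deriv q (poly g) (of_real \<alpha>)"

definition q_kernel11 ::
  "real \<Rightarrow> (complex poly \<Rightarrow> complex) \<Rightarrow> (nat \<Rightarrow> complex poly) \<Rightarrow> nat \<Rightarrow> complex \<Rightarrow> complex \<Rightarrow> complex" where
  "q_kernel11 q u p n x y =
     (\<Sum>k<n. q_deriv q (poly (p k)) x * q_deriv q (poly (p k)) y / u ((p k)\<^sup>2))"

end

theory Submission
  imports Defs
begin

text \<open>
  Write \<open>D f\<close> for the q-derivative of \<open>f\<close> at \<open>\<alpha>\<close>, \<open>h\<^sub>n\<close> for the value of the functional at the square of
  \<open>p n\<close>, and \<open>w = (x - \<alpha>)(x - \<alpha> q)\<close>. Everything rests on two features of the Sobolev form: it is a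
  rank-one perturbation \<open>S f g = u (f g) + N D f D g\<close> of a form for which multiplication by \<open>w\<close> is
  symmetric; and \<open>D (w f) = 0\<close> for every \<open>f\<close>, because \<open>w\<close> vanishes at the two nodes \<open>\<alpha>\<close> and \<open>q \<alpha>\<close> from
  which \<open>D\<close> is computed or, if \<open>\<alpha> = 0\<close>, has a double root there. The argument is carried out for a
  general symmetric bilinear form and a general linear functional \<open>D\<close> in place of the
  q-derivative.

  The rank-one structure determines \<open>s n\<close>. For \<open>i < n\<close> orthogonality says
  \<open>u (s n * p i) = - N D (s n) D (p i)\<close>, which gives the coefficients of \<open>s n\<close> in the basis \<open>p\<close> up to
  the unknown factor \<open>D (s n)\<close>. Applying \<open>D\<close> to that expansion closes the system:
  \<open>c\<^sub>n D (s n) = D (p n)\<close> with \<open>c\<^sub>n = 1 + N K\<^sub>n\<close>. It follows that \<open>c\<^sub>n S (s n) (s n) = c\<^sub>n\<^sub>+\<^sub>1 h\<^sub>n\<close>; as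
  \<open>c\<^sub>0 = 1\<close> and the norms of both sequences are nonzero, induction shows that no \<open>c\<^sub>n\<close> vanishes, and the
  formula for the norms results.

  For the recurrence, \<open>D (w f) = 0\<close> makes multiplication by \<open>w\<close> symmetric for \<open>S\<close> as well, so the
  expansion of \<open>w s n\<close> in the basis \<open>s\<close> is banded. The coefficient of \<open>s j\<close> times the norm of \<open>s j\<close> is
  \<open>u (s n * w s j)\<close>, to be evaluated on the expansion of \<open>w s j\<close> in the basis \<open>p\<close>. Its terms with index
  below \<open>n\<close> contribute a multiple of \<open>\<Sum>i<n. a j i * D (p i)\<close>, and because \<open>D (w s j) = 0\<close> this sum is
  minus the corresponding sum over \<open>i \<ge> n\<close>; that exchange is what produces the sum from \<open>n + 1\<close> to
  \<open>j + 2\<close> in the statement.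
\<close>

section \<open>Linear functionals and expansions in monic bases\<close>

lemma linear_functionalI:
  assumes "\<And>f g. F (f + g) = F f + F g" and "\<And>c f. F (smult c f) = c * F f"
  shows "linear_functional F"
  using assms unfolding Vector_Spaces.linear_iff
  by (intro conjI vector_space.intro) (auto simp: algebra_simps smult_add_right smult_add_left)

lemma linear_functional_add: "linear_functional F \<Longrightarrow> F (f + g) = F f + F g"
  by (simp add: Vector_Spaces.linear_iff)

lemma linear_functional_smult: "linear_functional F \<Longrightarrow> F (smult c f) = c * F f"
  by (simp add: Vector_Spaces.linear_iff)

lemma linear_functional_sum:
  assumes "linear_functional F"
  shows "F (\<Sum>i\<in>A. smult (c i) (f i)) = (\<Sum>i\<in>A. c i * F (f i))"
proof -
  have "F 0 = 0"
    using linear_functional_smult[OF assms, of 0 0] by simp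
  then show ?thesis
    by (induction A rule: infinite_finite_induct)
       (simp_all add: linear_functional_add[OF assms] linear_functional_smult[OF assms])
qed

lemma monic_degree_0:
  assumes "degree f = 0" and "lead_coeff f = 1"
  shows "f = 1"
proof -
  obtain d where "f = [:d:]"
    using assms(1) by (rule degree_eq_zeroE)
  with assms(2) show ?thesis by (simp add: one_pCons)
qed

lemma monic_basis_expansion:
  fixes b :: "nat \<Rightarrow> 'a::comm_ring_1 poly"
  assumes b: "\<And>n. degree (b n) = n" "\<And>n. lead_coeff (b n) = 1"
  shows "degree f \<le> m \<Longrightarrow> \<exists>c. f = (\<Sum>i\<le>m. smult (c i) (b i))"
proof (induction m arbitrary: f)
  case 0
  then have "degree f = 0" by simp
  then obtain d where "f = [:d:]"
    by (rule degree_eq_zeroE)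
  moreover have "b 0 = 1"
    using b[of 0] by (intro monic_degree_0)
  ultimately have f: "f = (\<Sum>i\<le>0. smult d (b i))"
    by simp
  show ?case
    by (rule exI[of _ "\<lambda>_. d"]) (rule f)
next
  case (Suc m)
  let ?a = "coeff f (Suc m)"
  let ?g = "f - smult ?a (b (Suc m))"
  have "coeff ?g i = 0" if "i > m" for i
  proof (cases "i = Suc m")
    case True
    moreover have "coeff (b (Suc m)) (Suc m) = 1"
      using b(2)[of "Suc m"] unfolding b(1) .
    ultimately show ?thesis by (simp only: coeff_diff coeff_smult mult_1_right diff_self)
  next
    case False
    then have "i > Suc m" using that by simp
    then have "degree f < i" "degree (b (Suc m)) < i"
      using Suc.prems unfolding b(1) by simp_all
    then show ?thesis by (simp only: coeff_diff coeff_smult coeff_eq_0 mult_zero_right diff_self)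
  qed
  then have "degree ?g \<le> m"
    by (intro degree_le allI impI)
  then obtain c where c: "?g = (\<Sum>i\<le>m. smult (c i) (b i))"
    using Suc.IH by blast
  have "f = ?g + smult ?a (b (Suc m))" by simp
  also have "\<dots> = (\<Sum>i\<le>Suc m. smult ((c(Suc m := ?a)) i) (b i))"
    unfolding c by simp
  finally have f: "f = (\<Sum>i\<le>Suc m. smult ((c(Suc m := ?a)) i) (b i))" .
  show ?case
    by (rule exI[of _ "c(Suc m := ?a)"]) (rule f)
qed

lemma orthogonal_coefficient:
  assumes lin: "\<And>g. linear_functional (\<lambda>f. B f g)"
    and "monic_orthogonal_seq B b"
    and f: "f = (\<Sum>i\<in>I. smult (c i) (b i))" and "finite I"
  shows "B f (b k) = (if k \<in> I then c k * B (b k) (b k) else 0)"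
proof -
  have "B f (b k) = (\<Sum>i\<in>I. c i * B (b i) (b k))"
    unfolding f by (rule linear_functional_sum[OF lin])
  also have "\<dots> = (\<Sum>i\<in>I. if i = k then c k * B (b k) (b k) else 0)"
    using assms(2) by (intro sum.cong) (auto simp: monic_orthogonal_seq_def)
  finally show ?thesis using \<open>finite I\<close> by simp
qed

text \<open>Some expansion exists because the change to a monic basis is triangular; the nonzero norms then
  identify its coefficients.\<close>

lemma orthogonal_expansion:
  assumes lin: "\<And>g. linear_functional (\<lambda>f. B f g)"
    and b: "monic_orthogonal_seq B b" and "degree f \<le> m"
  shows "f = (\<Sum>i\<le>m. smult (B f (b i) / B (b i) (b i)) (b i))"
proof -
  obtain c where c: "f = (\<Sum>i\<le>m. smult (c i) (b i))"
    using monic_basis_expansion[OF _ _ \<open>degree f \<le> m\<close>, of b] b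
    unfolding monic_orthogonal_seq_def by blast
  have "c i = B f (b i) / B (b i) (b i)" if "i \<le> m" for i
    using orthogonal_coefficient[OF lin b c, of i] that b
    by (simp add: monic_orthogonal_seq_def)
  then show ?thesis
    by (subst c) (intro sum.cong, auto)
qed

section \<open>Rank-one perturbations of a symmetric form\<close>

locale rank_one_perturbation =
  fixes B S :: "complex poly \<Rightarrow> complex poly \<Rightarrow> complex"
    and D :: "complex poly \<Rightarrow> complex" and M :: complex
    and p s :: "nat \<Rightarrow> complex poly"
  assumes B_linear: "\<And>g. linear_functional (\<lambda>f. B f g)"
    and B_commute: "\<And>f g. B f g = B g f"
    and D_linear: "linear_functional D"
    and S_eq: "\<And>f g. S f g = B f g + M * D f * D g"
    and p_orth: "monic_orthogonal_seq B p"
    and s_orth: "monic_orthogonal_seq S s"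
begin

text \<open>By the matrix determinant lemma this is the quotient of the Gram determinants of \<open>S\<close> and of \<open>B\<close>
  on the polynomials of degree less than \<open>n\<close>.\<close>

definition gram_ratio :: "nat \<Rightarrow> complex" where
  "gram_ratio n = 1 + M * (\<Sum>k<n. D (p k) * D (p k) / B (p k) (p k))"

lemma S_linear: "linear_functional (\<lambda>f. S f g)"
  by (rule linear_functionalI)
     (simp_all add: S_eq algebra_simps linear_functional_add[OF B_linear]
       linear_functional_smult[OF B_linear] linear_functional_add[OF D_linear]
       linear_functional_smult[OF D_linear])

lemma S_commute: "S f g = S g f"
  by (simp add: S_eq B_commute mult.commute mult.left_commute)

lemma degree_p [simp]: "degree (p n) = n" and degree_s [simp]: "degree (s n) = n"
  and lead_coeff_p [simp]: "coeff (p n) n = 1" and lead_coeff_s [simp]: "coeff (s n) n = 1"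
  and B_p_nonzero [simp]: "B (p n) (p n) \<noteq> 0" and S_s_nonzero [simp]: "S (s n) (s n) \<noteq> 0"
  using p_orth[unfolded monic_orthogonal_seq_def] s_orth[unfolded monic_orthogonal_seq_def]
  by (auto dest!: spec[of _ n])

lemma S_s_lower_degree:
  assumes "degree f < n"
  shows "S (s n) f = 0"
proof -
  obtain d where d: "f = (\<Sum>i\<le>degree f. smult (d i) (s i))"
    using monic_basis_expansion[of s f "degree f"] by auto
  have "S f (s n) = 0"
    using orthogonal_coefficient[OF S_linear s_orth d, of n] assms by simp
  then show ?thesis by (simp add: S_commute)
qed

text \<open>Orthogonality with respect to \<open>S\<close>, read as a statement about \<open>B\<close>: this gives the lower
  coefficients of \<open>s n\<close> in the basis \<open>p\<close>, up to the still unknown number \<open>D (s n)\<close>.\<close>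

lemma B_s_p_lower: "i < n \<Longrightarrow> B (s n) (p i) = - M * D (s n) * D (p i)"
  using S_s_lower_degree[of "p i" n] by (simp add: S_eq add_eq_0_iff)

lemma B_s_p_upper:
  assumes "n \<le> i"
  shows "B (s n) (p i) = (if i = n then B (p n) (p n) else 0)"
proof -
  obtain d where d: "s n = (\<Sum>k\<le>n. smult (d k) (p k))"
    using monic_basis_expansion[of p "s n" n] by auto
  have "coeff (s n) n = (\<Sum>k\<le>n. d k * coeff (p k) n)"
    by (subst d) (simp add: coeff_sum)
  also have "\<dots> = (\<Sum>k\<le>n. if k = n then d n else 0)"
    by (intro sum.cong) (auto simp: coeff_eq_0)
  finally have "d n = 1" by simp
  then show ?thesis
    using orthogonal_coefficient[OF B_linear p_orth d, of i] assms by auto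
qed

text \<open>Applying \<open>D\<close> to the expansion of \<open>s n\<close> gives \<open>D (s n) = D (p n) - (gram_ratio n - 1) * D (s n)\<close>,
  a linear equation for \<open>D (s n)\<close>.\<close>

lemma D_s: "gram_ratio n * D (s n) = D (p n)"
proof -
  have "s n = (\<Sum>k\<le>n. smult (B (s n) (p k) / B (p k) (p k)) (p k))"
    by (rule orthogonal_expansion[OF B_linear p_orth]) simp
  then have "D (s n) = (\<Sum>k\<le>n. B (s n) (p k) / B (p k) (p k) * D (p k))"
    using linear_functional_sum[OF D_linear, of "\<lambda>k. B (s n) (p k) / B (p k) (p k)" p "{..n}"]
    by simp
  also have "\<dots> = (\<Sum>k<n. B (s n) (p k) / B (p k) (p k) * D (p k)) + D (p n)"
    by (simp add: lessThan_Suc_atMost[symmetric] B_s_p_upper)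
  also have "(\<Sum>k<n. B (s n) (p k) / B (p k) (p k) * D (p k)) = - ((gram_ratio n - 1) * D (s n))"
    unfolding gram_ratio_def
    by (simp add: B_s_p_lower sum_distrib_left sum_distrib_right sum_negf algebra_simps)
  finally show ?thesis by (simp add: algebra_simps)
qed

text \<open>Both sequences being monic, \<open>s n\<close> and \<open>p n\<close> differ by a polynomial of lower degree.\<close>

lemma S_s_self: "S (s n) (s n) = S (s n) (p n)"
proof (cases n)
  case 0
  have "s 0 = 1" "p 0 = 1"
    by (simp_all add: monic_degree_0)
  with 0 show ?thesis by simp
next
  case (Suc m)
  let ?r = "s n - p n"
  have "coeff ?r i = 0" if "i > m" for i
    using that Suc by (cases "i = n") (simp_all add: coeff_eq_0)
  then have "degree ?r < n"
    using Suc by (simp add: degree_le le_imp_less_Suc)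
  then have "S (s n) ?r = 0" by (rule S_s_lower_degree)
  moreover have "S (s n) (?r + p n) = S (s n) ?r + S (s n) (p n)"
    using linear_functional_add[OF S_linear, of ?r "p n" "s n"] by (simp add: S_commute)
  ultimately show ?thesis by simp
qed

lemma gram_ratio_Suc: "gram_ratio (Suc n) = gram_ratio n + M * D (p n) * D (p n) / B (p n) (p n)"
  by (simp add: gram_ratio_def algebra_simps)

lemma gram_ratio_mult_norm: "gram_ratio n * S (s n) (s n) = gram_ratio (Suc n) * B (p n) (p n)"
proof -
  have "gram_ratio n * S (s n) (s n)
      = gram_ratio n * B (p n) (p n) + M * (gram_ratio n * D (s n)) * D (p n)"
    unfolding S_s_self by (simp add: S_eq B_s_p_upper algebra_simps)
  also have "\<dots> = gram_ratio (Suc n) * B (p n) (p n)"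
    unfolding D_s by (simp add: gram_ratio_Suc distrib_right)
  finally show ?thesis .
qed

text \<open>The value at \<open>0\<close> is \<open>1\<close>, and by the preceding lemma the quotient of consecutive values is a
  quotient of nonzero norms: the existence of the sequence \<open>s\<close> is what forces this.\<close>

lemma gram_ratio_nonzero: "gram_ratio n \<noteq> 0"
proof (induction n)
  case 0
  show ?case by (simp add: gram_ratio_def)
next
  case (Suc n)
  then have "gram_ratio (Suc n) * B (p n) (p n) \<noteq> 0"
    unfolding gram_ratio_mult_norm[symmetric] by simp
  then show ?case by simp
qed

lemma norm_eq: "S (s n) (s n) = gram_ratio (Suc n) / gram_ratio n * B (p n) (p n)"
  using gram_ratio_mult_norm[of n] gram_ratio_nonzero[of n] by (simp add: field_simps)

text \<open>Since \<open>D g = 0\<close>, the sum of \<open>a i * D (p i)\<close> over \<open>i < n\<close> can be traded for the one over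
  \<open>i \<ge> n\<close>. This leaves only coefficients of \<open>g\<close> from index \<open>n\<close> on, and the term with \<open>i = n\<close> is what
  turns \<open>gram_ratio n\<close> into \<open>gram_ratio (Suc n)\<close>.\<close>

lemma B_s_annihilated:
  assumes g: "g = (\<Sum>i\<le>m. smult (a i) (p i))" and "D g = 0" and "n \<le> m"
  shows "B (s n) g =
    (a n * B (p n) (p n) * gram_ratio (Suc n) + M * D (p n) * (\<Sum>i = n + 1..m. a i * D (p i)))
      / gram_ratio n"
proof -
  have split: "(\<Sum>i\<le>m. F i) = (\<Sum>i<n. F i) + F n + (\<Sum>i = n + 1..m. F i)" for F :: "nat \<Rightarrow> complex"
  proof -
    have "{..m} = {..n} \<union> {n + 1..m}" using \<open>n \<le> m\<close> by auto
    then have "(\<Sum>i\<le>m. F i) = (\<Sum>i\<le>n. F i) + (\<Sum>i = n + 1..m. F i)"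
      by (simp add: sum.union_disjoint)
    then show ?thesis by (simp add: lessThan_Suc_atMost[symmetric])
  qed
  have "D g = (\<Sum>i\<le>m. a i * D (p i))"
    unfolding g by (rule linear_functional_sum[OF D_linear])
  then have "(\<Sum>i\<le>m. a i * D (p i)) = 0"
    using \<open>D g = 0\<close> by simp
  then have low: "(\<Sum>i<n. a i * D (p i)) = - (a n * D (p n) + (\<Sum>i = n + 1..m. a i * D (p i)))"
    unfolding split by (simp only: eq_neg_iff_add_eq_0 add.assoc)
  have "B (s n) g = (\<Sum>i\<le>m. a i * B (s n) (p i))"
    unfolding g B_commute[of "s n"] by (rule linear_functional_sum[OF B_linear])
  also have "\<dots> = (\<Sum>i<n. a i * B (s n) (p i)) + a n * B (p n) (p n)"
    unfolding split by (simp add: B_s_p_upper)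
  also have "(\<Sum>i<n. a i * B (s n) (p i)) = - M * D (s n) * (\<Sum>i<n. a i * D (p i))"
    unfolding sum_distrib_left by (intro sum.cong) (simp_all add: B_s_p_lower algebra_simps)
  finally have "B (s n) g = a n * B (p n) (p n)
      + M * D (s n) * (a n * D (p n) + (\<Sum>i = n + 1..m. a i * D (p i)))"
    unfolding low by (simp only: minus_mult_minus mult_minus_left mult_minus_right minus_minus add.commute)
  moreover have "D (s n) = D (p n) / gram_ratio n"
    using D_s[of n] gram_ratio_nonzero[of n] by (simp add: field_simps)
  moreover have "a n * B (p n) (p n) * gram_ratio (Suc n)
      = a n * (gram_ratio n * B (p n) (p n) + M * D (p n) * D (p n))"
    by (simp add: gram_ratio_Suc algebra_simps)
  ultimately show ?thesis
    using gram_ratio_nonzero[of n] by (simp add: field_simps)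
qed

text \<open>Multiplication by \<open>w\<close> is symmetric for \<open>B\<close>, and since \<open>D\<close> kills its image also for \<open>S\<close>.
  Hence \<open>w * s n\<close> is orthogonal to \<open>s j\<close> whenever \<open>w * s j\<close> has degree less than \<open>n\<close>, and the
  remaining coefficients come from the preceding lemma with \<open>g = w * s j\<close>.\<close>

lemma multiplication_recurrence:
  assumes w_B: "\<And>f g. B (w * f) g = B f (w * g)"
    and w_D: "\<And>f. D (w * f) = 0"
    and w: "degree w = d" "lead_coeff w = 1"
    and a: "\<And>j. w * s j = (\<Sum>i\<le>j + d. smult (a j i) (p i))"
  defines "lam \<equiv> \<lambda>n j. S (w * s n) (s j) / S (s j) (s j)"
  shows "d \<le> n \<Longrightarrow> w * s n = (\<Sum>j = n - d..n + d. smult (lam n j) (s j))"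
    and "lam n (n + d) = 1"
    and "n \<le> j + d \<Longrightarrow> lam n j =
      (a j n * B (p n) (p n) * gram_ratio (Suc n) + M * D (p n) * (\<Sum>i = n + 1..j + d. a j i * D (p i)))
        / (gram_ratio n * S (s j) (s j))"
proof -
  have "w \<noteq> 0" using w(2) by auto
  moreover have "s j \<noteq> 0" for j
  proof
    assume "s j = 0"
    with lead_coeff_s[of j] show False by (simp only: coeff_0 zero_neq_one)
  qed
  ultimately have deg: "degree (w * s j) = j + d" for j
    using w(1) by (simp add: degree_mult_eq)
  have w_S: "S (w * s n) (s j) = B (s n) (w * s j)" for n j
    by (simp add: S_eq w_D w_B)
  have expand: "w * s n = (\<Sum>j\<le>n + d. smult (lam n j) (s j))"
    unfolding lam_def by (rule orthogonal_expansion[OF S_linear s_orth]) (simp add: deg)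
  have "lam n j = 0" if "j + d < n" for j
  proof -
    have "S (s n) (w * s j) = 0"
      by (rule S_s_lower_degree) (simp add: deg that)
    then show ?thesis
      by (simp add: lam_def w_S) (simp add: S_eq w_D)
  qed
  then have "(\<Sum>j\<le>n + d. smult (lam n j) (s j)) = (\<Sum>j = n - d..n + d. smult (lam n j) (s j))"
    by (intro sum.mono_neutral_right) (auto simp: not_le)
  with expand show "w * s n = (\<Sum>j = n - d..n + d. smult (lam n j) (s j))"
    by simp
  have "1 = coeff (w * s n) (n + d)"
    using deg[of n] w lead_coeff_mult[of w "s n"] by simp
  also have "\<dots> = (\<Sum>j\<le>n + d. lam n j * coeff (s j) (n + d))"
    by (subst expand) (simp add: coeff_sum)
  also have "\<dots> = (\<Sum>j\<le>n + d. if j = n + d then lam n (n + d) else 0)"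
    by (intro sum.cong) (auto simp: coeff_eq_0)
  finally show "lam n (n + d) = 1" by simp
  show "lam n j =
      (a j n * B (p n) (p n) * gram_ratio (Suc n) + M * D (p n) * (\<Sum>i = n + 1..j + d. a j i * D (p i)))
        / (gram_ratio n * S (s j) (s j))" if "n \<le> j + d"
    using B_s_annihilated[OF a w_D that] by (simp add: lam_def w_S)
qed

end

section \<open>The q-derivative at a point\<close>

lemma linear_functional_q_deriv:
  "linear_functional (\<lambda>f. q_deriv q (poly f) x)"
proof (cases "x = 0")
  case True
  have "deriv (poly f) 0 = poly (pderiv f) 0" for f :: "complex poly"
    by (rule DERIV_imp_deriv) (rule poly_DERIV)
  with True show ?thesis
    by (intro linear_functionalI) (simp_all add: q_deriv_def pderiv_add pderiv_smult)
next
  case False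
  then show ?thesis
    by (intro linear_functionalI)
       (simp_all add: q_deriv_def add_divide_distrib[symmetric] right_diff_distrib)
qed

text \<open>Away from \<open>0\<close> the difference quotient only uses the values at \<open>x\<close> and \<open>q x\<close>, both of which are
  roots; at \<open>0\<close> the two roots merge into a double root, which kills the derivative.\<close>

lemma q_deriv_node_multiple:
  "q_deriv q (poly ([:- x, 1:] * [:- (of_real q * x), 1:] * f)) x = 0"
proof (cases "x = 0")
  case True
  have "deriv (poly ([:0, 1:] * [:0, 1:] * f)) 0 = poly (pderiv ([:0, 1:] * [:0, 1:] * f)) 0"
    by (rule DERIV_imp_deriv) (rule poly_DERIV)
  with True show ?thesis
    by (simp add: q_deriv_def pderiv_mult del: mult_pCons_left mult_pCons_right)
next
  case False
  then show ?thesis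
    by (simp add: q_deriv_def del: mult_pCons_left mult_pCons_right)
qed

theorem proposition6:
  fixes q \<alpha> N :: real
    and u :: "complex poly \<Rightarrow> complex"
    and p s :: "nat \<Rightarrow> complex poly"
    and a :: "nat \<Rightarrow> nat \<Rightarrow> complex"
  defines "S \<equiv> sobolev_form q u \<alpha> N"
    and "D \<equiv> \<lambda>f. q_deriv q (poly f) (complex_of_real \<alpha>)"
    and "K \<equiv> \<lambda>n. q_kernel11 q u p n (complex_of_real \<alpha>) (complex_of_real \<alpha>)"
    and "w \<equiv> [:- complex_of_real \<alpha>, 1:] * [:- complex_of_real (\<alpha> * q), 1:]"
  assumes "0 < q" and "q < 1"
    and "quasi_definite u"
    and "monic_orthogonal_seq (\<lambda>f g. u (f * g)) p"
    and "monic_orthogonal_seq S s"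
    and "\<And>j. w * s j = (\<Sum>i\<le>j + 2. smult (a j i) (p i))"
  shows "(\<forall>n. S (s n) (s n) =
            (1 + complex_of_real N * K (n + 1)) / (1 + complex_of_real N * K n) * u ((p n)\<^sup>2)) \<and>
         (\<forall>n\<ge>2. \<exists>lam :: nat \<Rightarrow> complex.
            w * s n = (\<Sum>\<nu> = n - 2..n + 2. smult (lam \<nu>) (s \<nu>)) \<and>
            lam (n + 2) = 1 \<and>
            (\<forall>j\<in>{n - 2..n + 2}.
               lam j =
                 (a j n * u ((p n)\<^sup>2) * (1 + complex_of_real N * K (n + 1)) +
                  complex_of_real N * D (p n) * (\<Sum>i = n + 1..j + 2. a j i * D (p i))) /
                 ((1 + complex_of_real N * K n) * S (s j) (s j))))"
proof -
  have u: "linear_functional u"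
    using \<open>quasi_definite u\<close> by (simp add: quasi_definite_def)
  interpret P: rank_one_perturbation "\<lambda>f g. u (f * g)" S D "complex_of_real N" p s
  proof (rule rank_one_perturbation.intro)
    show "linear_functional (\<lambda>f. u (f * g))" for g
      by (rule linear_functionalI)
         (simp_all add: distrib_right linear_functional_add[OF u] linear_functional_smult[OF u])
    show "linear_functional D"
      unfolding D_def by (rule linear_functional_q_deriv)
    show "S f g = u (f * g) + complex_of_real N * D f * D g" for f g
      by (simp add: S_def D_def sobolev_form_def)
      show "u (f * g) = u (g * f)" for f g
      by (simp add: mult.commute)
    show "monic_orthogonal_seq (\<lambda>f g. u (f * g)) p" by (rule assms(8))
    show "monic_orthogonal_seq S s" by (rule assms(9))
  qed
  have c: "P.gram_ratio n = 1 + complex_of_real N * K n" for n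
    unfolding P.gram_ratio_def unfolding K_def q_kernel11_def D_def power2_eq_square ..
  have w: "degree w = 2" "lead_coeff w = 1"
    by (simp_all add: w_def numeral_2_eq_2)
  have w_D: "D (w * f) = 0" for f
    using q_deriv_node_multiple[of q "complex_of_real \<alpha>" f]
    by (simp add: D_def w_def mult.commute del: mult_pCons_left mult_pCons_right)
  have w_u: "u (w * f * g) = u (f * (w * g))" for f g
    by (simp only: mult.left_commute[of f w g] mult.assoc)
  note rec = P.multiplication_recurrence[OF w_u w_D w assms(10)]
  show ?thesis
  proof (intro conjI allI impI)
    show "S (s n) (s n) =
        (1 + complex_of_real N * K (n + 1)) / (1 + complex_of_real N * K n) * u ((p n)\<^sup>2)" for n
      using P.norm_eq[of n] by (simp add: c power2_eq_square)
    show "\<exists>lam :: nat \<Rightarrow> complex.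
            w * s n = (\<Sum>\<nu> = n - 2..n + 2. smult (lam \<nu>) (s \<nu>)) \<and>
            lam (n + 2) = 1 \<and>
            (\<forall>j\<in>{n - 2..n + 2}.
               lam j =
                 (a j n * u ((p n)\<^sup>2) * (1 + complex_of_real N * K (n + 1)) +
                  complex_of_real N * D (p n) * (\<Sum>i = n + 1..j + 2. a j i * D (p i))) /
                 ((1 + complex_of_real N * K n) * S (s j) (s j)))" if "2 \<le> n" for n
    proof (intro exI conjI ballI)
      show "w * s n = (\<Sum>\<nu> = n - 2..n + 2. smult (S (w * s n) (s \<nu>) / S (s \<nu>) (s \<nu>)) (s \<nu>))"
        by (rule rec(1)) fact
      show "S (w * s n) (s (n + 2)) / S (s (n + 2)) (s (n + 2)) = 1"
        by (rule rec(2))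
      fix j assume "j \<in> {n - 2..n + 2}"
      then have "n \<le> j + 2" by auto
      from rec(3)[OF this] show "S (w * s n) (s j) / S (s j) (s j) =
                 (a j n * u ((p n)\<^sup>2) * (1 + complex_of_real N * K (n + 1)) +
                  complex_of_real N * D (p n) * (\<Sum>i = n + 1..j + 2. a j i * D (p i))) /
                 ((1 + complex_of_real N * K n) * S (s j) (s j))"
        by (simp add: c power2_eq_square)
    qed
  qed
qed

end
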